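(* Let $R$ be a ring and let $G$ be a group. If the group ring $RG$ is a UQ ring, then $R$ is a UQ ring and $G$ is a $2$-group.
   Context: Rings are associative with identity, not necessarily commutative. $U(S)$ is the group of units of a ring $S$. An element $a\in S$ is quasinilpotent if $1-ax\in U(S)$ for every $x\in S$ with $ax=xa$; $QN(S)$ is the set of quasinilpotent elements of $S$. A ring $S$ is called a UQ ring if $U(S)=1+QN(S)$. $RG$ denotes the group ring of $G$ over $R$. A $2$-group is a (possibly infinite) group in which every element has finite order equal to a power of $2$. *)

theory Defs
  imports Complex_Main "HOL-Library.Poly_Mapping"
begin

text \<open>
  The group ring of a group \<open>'g\<close> over a ring \<open>'a\<close> is the type \<open>'g \<Rightarrow>\<^sub>0 'a\<close> of finitely
  supported functions, whose library multiplication is the convolution product.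
  The group \<open>'g\<close> is written additively (class \<open>group_add\<close>, which does not assume commutativity),
  so \<open>0\<close> is the identity of the group and \<open>x + y\<close> is the product of \<open>x\<close> and \<open>y\<close>.
\<close>

text \<open>Two-sided units; the predicate \<open>u dvd 1\<close> would only give one-sided invertibility
  in a noncommutative ring.\<close>

definition ring_units :: "'a::ring_1 set" where
  "ring_units = {u. \<exists>v. u * v = 1 \<and> v * u = 1}"

definition quasinilpotent :: "'a::ring_1 \<Rightarrow> bool" where
  "quasinilpotent a \<longleftrightarrow> (\<forall>x. a * x = x * a \<longrightarrow> 1 - a * x \<in> ring_units)"

definition QN :: "'a::ring_1 set" where
  "QN = {a. quasinilpotent a}"

definition UQ_ring :: "'a::ring_1 itself \<Rightarrow> bool" where
  "UQ_ring T \<longleftrightarrow> (ring_units :: 'a set) = {1 + q | q. q \<in> QN}"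

text \<open>The \<open>n\<close>-th power of a group element, in additive notation.\<close>

definition group_pow :: "'g::group_add \<Rightarrow> nat \<Rightarrow> 'g" where
  "group_pow g n = ((+) g ^^ n) 0"

definition has_order :: "'g::group_add \<Rightarrow> nat \<Rightarrow> bool" where
  "has_order g n \<longleftrightarrow>
     0 < n \<and> group_pow g n = 0 \<and> (\<forall>m. 0 < m \<and> m < n \<longrightarrow> group_pow g m \<noteq> 0)"

definition two_group :: "'g::group_add itself \<Rightarrow> bool" where
  "two_group T \<longleftrightarrow> (\<forall>g::'g. \<exists>k. has_order g (2 ^ k))"

end

theory Submission
  imports Defs "HOL-Computational_Algebra.Euclidean_Algorithm"
begin

text \<open>
  In a UQ ring \<open>- 1 = 1 + (- 2)\<close> makes \<open>- 2\<close> quasinilpotent, so \<open>2\<close> lies in the Jacobson radical.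
  For a unit \<open>u\<close> and odd \<open>m\<close>, the element \<open>N = 1 + u + \<dots> + u\<^sup>m\<^sup>-\<^sup>1\<close> satisfies
  \<open>m - N = (1 - u) z\<close> for a polynomial \<open>z\<close> in \<open>u\<close>; as \<open>u - 1\<close> is quasinilpotent, \<open>N - (m - 1)\<close> is
  a unit, and hence so is \<open>N\<close>.  Apply this to group elements.  If \<open>u\<^sup>m = 1\<close>, then
  \<open>(1 - u) N = 0\<close> forces \<open>u = 1\<close>, so there is no odd torsion.  If \<open>u\<close> has infinite order, an inverse
  \<open>v\<close> of \<open>1 + u + u\<^sup>2\<close> satisfies \<open>(1 - u\<^sup>3) v = 1 - u\<close>, so its coefficients are constant along the
  nonnegative and along the negative powers of \<open>u\<^sup>3\<close>, but jump by \<open>1\<close> at the identity, which is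
  impossible for finite support.  The UQ property descends to \<open>R\<close> because an element of \<open>R\<close> that is
  a unit of \<open>RG\<close> is a unit of \<open>R\<close>: take the coefficient of its inverse at the identity.
\<close>

section \<open>Units and quasinilpotent elements in a UQ ring\<close>

lemma ring_unitsI: "u * v = 1 \<Longrightarrow> v * u = 1 \<Longrightarrow> u \<in> ring_units"
  unfolding ring_units_def by blast

lemma ring_unitsE:
  assumes "u \<in> ring_units"
  obtains v where "u * v = 1" "v * u = 1"
  using assms unfolding ring_units_def by blast

lemma ring_units_mult:
  assumes "u \<in> ring_units" "w \<in> ring_units"
  shows "u * w \<in> ring_units"
proof -
  obtain u' where u': "u * u' = 1" "u' * u = 1" using assms(1) by (rule ring_unitsE)
  obtain w' where w': "w * w' = 1" "w' * w = 1" using assms(2) by (rule ring_unitsE)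
  show ?thesis
  proof (rule ring_unitsI)
    show "u * w * (w' * u') = 1"
      by (metis u'(1) w'(1) mult.assoc mult.right_neutral)
    show "w' * u' * (u * w) = 1"
      by (metis u'(2) w'(2) mult.assoc mult.right_neutral)
  qed
qed

lemma one_plus_QN_unit:
  assumes "q \<in> QN"
  shows "1 + q \<in> ring_units"
proof -
  have "q * (- 1) = (- 1) * q" by simp
  with assms have "1 - q * (- 1) \<in> ring_units"
    unfolding QN_def quasinilpotent_def by blast
  then show ?thesis by simp
qed

text \<open>The inclusion of \<open>1 + QN\<close> in the units holds in every ring (test
  quasinilpotence against \<open>- 1\<close>), so only the converse inclusion carries
  content.\<close>

lemma UQ_ring_iff:
  "UQ_ring TYPE('a::ring_1) \<longleftrightarrow> (\<forall>u\<in>ring_units. quasinilpotent (u - 1 :: 'a))"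
proof
  assume *: "UQ_ring TYPE('a)"
  show "\<forall>u\<in>ring_units. quasinilpotent (u - 1 :: 'a)"
  proof
    fix u :: 'a
    assume "u \<in> ring_units"
    with * obtain q where "u = 1 + q" "q \<in> QN" unfolding UQ_ring_def by blast
    then show "quasinilpotent (u - 1)" by (simp add: QN_def)
  qed
next
  assume *: "\<forall>u\<in>ring_units. quasinilpotent (u - 1 :: 'a)"
  have "u \<in> {1 + q |q. q \<in> QN}" if "u \<in> ring_units" for u :: 'a
  proof -
    have "u = 1 + (u - 1)" "u - 1 \<in> QN" using * that by (auto simp: QN_def)
    then show ?thesis by blast
  qed
  then show "UQ_ring TYPE('a)"
    unfolding UQ_ring_def using one_plus_QN_unit by blast
qed

lemma UQ_ring_commute_unit:
  fixes u x :: "'a::ring_1"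
  assumes "UQ_ring TYPE('a)" "u \<in> ring_units" "u * x = x * u"
  shows "1 + (u - 1) * x \<in> ring_units"
proof -
  have "quasinilpotent (u - 1)" using assms UQ_ring_iff by blast
  moreover have "(u - 1) * (- x) = (- x) * (u - 1)"
    using assms(3) by (simp add: algebra_simps)
  ultimately have "1 - (u - 1) * (- x) \<in> ring_units"
    unfolding quasinilpotent_def by blast
  then show ?thesis by simp
qed

text \<open>Every element commutes with the unit \<open>- 1\<close>, so \<open>1 + 2 * y\<close> is
  a unit for all \<open>y\<close>; then factor \<open>w + 2 * x\<close> as
  \<open>w * (1 + 2 * (w' * x))\<close>, where \<open>w'\<close> is the inverse of
  \<open>w\<close>.\<close>

lemma UQ_ring_unit_add_even:
  fixes w x :: "'a::ring_1"
  assumes "UQ_ring TYPE('a)" "w \<in> ring_units"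
  shows "w + 2 * x \<in> ring_units"
proof -
  obtain w' where w': "w * w' = 1" "w' * w = 1" using assms(2) by (rule ring_unitsE)
  have "- 1 \<in> (ring_units :: 'a set)" by (rule ring_unitsI[of _ "- 1"]) auto
  from UQ_ring_commute_unit[OF assms(1) this, of "- (w' * x)"]
  have "1 + 2 * (w' * x) \<in> ring_units" by (simp add: algebra_simps)
  from ring_units_mult[OF assms(2) this]
  have "w + w * (2 * (w' * x)) \<in> ring_units" by (simp add: algebra_simps)
  also have "w * (2 * (w' * x)) = 2 * (w * w' * x)"
    by (simp add: mult_2 distrib_left mult.assoc)
  finally show ?thesis using w' by simp
qed

section \<open>Geometric sums and odd torsion of units\<close>

lemma one_minus_mult_power_sum:
  fixes u :: "'a::ring_1"
  shows "(1 - u) * (\<Sum>i<n. u ^ i) = 1 - u ^ n"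
proof (induction n)
  case (Suc n)
  then show ?case by (simp add: distrib_left left_diff_distrib)
qed simp

lemma power_sum_commute:
  fixes u :: "'a::ring_1"
  shows "u * (\<Sum>i<n. u ^ i) = (\<Sum>i<n. u ^ i) * u"
  by (simp add: sum_distrib_left sum_distrib_right power_commutes)

text \<open>The right-hand side is the sum of the \<open>1 - u ^ i\<close> for \<open>i < n\<close>,
  each divisible by \<open>1 - u\<close>; so \<open>z\<close> is a sum of shorter geometric
  sums.\<close>

lemma power_sum_decomp:
  fixes u :: "'a::ring_1"
  shows "\<exists>z. u * z = z * u \<and> (1 - u) * z = of_nat n - (\<Sum>i<n. u ^ i)"
proof (induction n)
  case 0
  show ?case by (intro exI[of _ 0]) auto
next
  case (Suc n)
  then obtain z where z: "u * z = z * u" "(1 - u) * z = of_nat n - (\<Sum>i<n. u ^ i)" by blast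
  have "(1 - u) * (z + (\<Sum>i<n. u ^ i)) = of_nat (Suc n) - (\<Sum>i<Suc n. u ^ i)"
    by (simp only: distrib_left z one_minus_mult_power_sum) simp
  moreover have "u * (z + (\<Sum>i<n. u ^ i)) = (z + (\<Sum>i<n. u ^ i)) * u"
    by (simp only: distrib_left distrib_right z power_sum_commute)
  ultimately show ?case by blast
qed

lemma UQ_ring_odd_power_sum_unit:
  fixes u :: "'a::ring_1"
  assumes "UQ_ring TYPE('a)" "u \<in> ring_units" "odd m"
  shows "(\<Sum>i<m. u ^ i) \<in> ring_units"
proof -
  obtain k where k: "m = 2 * k + 1" using assms(3) by (rule oddE)
  obtain z where z: "u * z = z * u" "(1 - u) * z = of_nat m - (\<Sum>i<m. u ^ i)"
    using power_sum_decomp by blast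
  have "(u - 1) * z = (\<Sum>i<m. u ^ i) - of_nat m"
    using z(2) by (simp add: algebra_simps)
  with UQ_ring_commute_unit[OF assms(1,2) z(1)]
  have "1 + ((\<Sum>i<m. u ^ i) - of_nat m) \<in> ring_units" by simp
  \<comment> \<open>Since \<open>m = 2 * k + 1\<close>, the unit just found is the power sum minus
    \<open>2 * k\<close>.\<close>
  from UQ_ring_unit_add_even[OF assms(1) this, of "of_nat k"]
  show ?thesis by (simp add: k)
qed

lemma UQ_ring_odd_torsion:
  fixes u :: "'a::ring_1"
  assumes "UQ_ring TYPE('a)" "u ^ m = 1" "odd m"
  shows "u = 1"
proof -
  from assms(3) obtain n where m: "m = Suc n" by (cases m) auto
  have "u \<in> ring_units"
    using assms(2) by (intro ring_unitsI[of _ "u ^ n"]) (auto simp: m power_commutes)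
  from UQ_ring_odd_power_sum_unit[OF assms(1) this assms(3)]
  obtain v where v: "(\<Sum>i<m. u ^ i) * v = 1" by (rule ring_unitsE)
  have "1 - u = (1 - u) * (\<Sum>i<m. u ^ i) * v"
    by (simp only: mult.assoc v mult_1_right)
  also have "\<dots> = 0" by (simp add: one_minus_mult_power_sum assms(2))
  finally show ?thesis by simp
qed

section \<open>Coefficients in the group ring and descent to the base ring\<close>

lemma lookup_single_mult:
  fixes v :: "'g::group_add \<Rightarrow>\<^sub>0 'a::semiring_0"
  shows "Poly_Mapping.lookup (Poly_Mapping.single g a * v) k = a * Poly_Mapping.lookup v (- g + k)"
proof -
  have "k = g + h \<longleftrightarrow> h = - g + k" for h by (metis add_minus_cancel minus_add_cancel)
  then show ?thesis by (simp add: lookup_mult lookup_single when_mult)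
qed

lemma lookup_mult_single_0:
  fixes v :: "'g::group_add \<Rightarrow>\<^sub>0 'a::semiring_0"
  shows "Poly_Mapping.lookup (v * Poly_Mapping.single 0 a) k = Poly_Mapping.lookup v k * a"
proof -
  have "((a when 0 = h) when k = l + h) = ((a when k = l) when h = 0)" for h l :: 'g
    by (simp add: when_def)
  then show ?thesis by (simp add: lookup_mult lookup_single mult_when)
qed

lemma single_0_unit_iff:
  "Poly_Mapping.single (0::'g::group_add) a \<in> ring_units \<longleftrightarrow> (a::'a::ring_1) \<in> ring_units"
proof
  assume "Poly_Mapping.single (0::'g) a \<in> ring_units"
  then obtain v where v: "Poly_Mapping.single (0::'g) a * v = 1" "v * Poly_Mapping.single 0 a = 1"
    by (rule ring_unitsE)
  show "a \<in> ring_units"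
  proof (rule ring_unitsI)
    show "a * Poly_Mapping.lookup v 0 = 1"
      using arg_cong[OF v(1), of "\<lambda>f. Poly_Mapping.lookup f 0"]
      by (simp add: lookup_single_mult lookup_one)
    show "Poly_Mapping.lookup v 0 * a = 1"
      using arg_cong[OF v(2), of "\<lambda>f. Poly_Mapping.lookup f 0"]
      by (simp add: lookup_mult_single_0 lookup_one)
  qed
next
  assume "a \<in> ring_units"
  then obtain b where "a * b = 1" "b * a = 1" by (rule ring_unitsE)
  then show "Poly_Mapping.single (0::'g) a \<in> ring_units"
    by (intro ring_unitsI[of _ "Poly_Mapping.single 0 b"]) (simp_all add: mult_single)
qed

lemma UQ_ring_coefficients:
  assumes "UQ_ring TYPE('g::group_add \<Rightarrow>\<^sub>0 'a::ring_1)"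
  shows "UQ_ring TYPE('a)"
  unfolding UQ_ring_iff quasinilpotent_def
proof (intro ballI allI impI)
  fix u x :: 'a
  assume u: "u \<in> ring_units" and "(u - 1) * x = x * (u - 1)"
  then have "u * x = x * u" by (simp add: algebra_simps)
  then have "Poly_Mapping.single (0::'g) u * Poly_Mapping.single 0 (- x)
      = Poly_Mapping.single 0 (- x) * Poly_Mapping.single 0 u"
    by (simp add: mult_single)
  from UQ_ring_commute_unit[OF assms _ this] u
  have "1 + (Poly_Mapping.single (0::'g) u - 1) * Poly_Mapping.single 0 (- x) \<in> ring_units"
    by (simp add: single_0_unit_iff)
  also have "1 + (Poly_Mapping.single (0::'g) u - 1) * Poly_Mapping.single 0 (- x)
      = Poly_Mapping.single 0 (1 - (u - 1) * x)"
    by (simp add: single_uminus single_diff left_diff_distrib mult_single)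
  finally show "1 - (u - 1) * x \<in> ring_units" by (simp only: single_0_unit_iff)
qed

section \<open>Powers of group elements\<close>

lemma group_pow_simps [simp]:
  "group_pow g 0 = 0" "group_pow g (Suc n) = g + group_pow g n"
  unfolding group_pow_def by simp_all

lemma group_pow_add: "group_pow g (m + n) = group_pow g m + group_pow g n"
  by (induction m) (simp_all add: add.assoc)

lemma group_pow_mult: "group_pow g (m * n) = group_pow (group_pow g m) n"
  by (induction n) (simp_all add: group_pow_add)

lemma group_pow_uminus: "group_pow (- g) n = - group_pow g n"
proof (induction n)
  case (Suc n)
  have "group_pow g (Suc n) = group_pow g n + g"
    using group_pow_add[of g n 1] by simp
  with Suc show ?case by (simp only: group_pow_simps minus_add)
qed simp

lemma inj_group_pow:
  assumes "\<And>n. 0 < n \<Longrightarrow> group_pow g n \<noteq> 0"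
  shows "inj (group_pow g)"
proof (rule linorder_injI)
  fix m n :: nat
  assume "m < n"
  then have "group_pow g n = group_pow g m + group_pow g (n - m)"
    by (simp flip: group_pow_add)
  with assms[of "n - m"] \<open>m < n\<close> show "group_pow g m \<noteq> group_pow g n"
    by (metis add.right_neutral add_left_cancel zero_less_diff)
qed

lemma single_power: "Poly_Mapping.single g (1::'a::ring_1) ^ n = Poly_Mapping.single (group_pow g n) 1"
  by (induction n) (simp_all add: mult_single)

lemma single_1_unit: "Poly_Mapping.single (g::'g::group_add) (1::'a::ring_1) \<in> ring_units"
  by (rule ring_unitsI[of _ "Poly_Mapping.single (- g) 1"]) (simp_all add: mult_single)

section \<open>Torsion from finite support\<close>

lemma lookup_eq_0_if_const_on_inj:
  assumes "inj (f :: nat \<Rightarrow> 'g)" "\<And>n. Poly_Mapping.lookup v (f n) = c"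
  shows "c = 0"
proof (rule ccontr)
  assume "c \<noteq> 0"
  then have "range f \<subseteq> Poly_Mapping.keys v" using assms(2) by (auto simp: in_keys_iff)
  then have "finite (range f)" by (rule finite_subset) simp
  with assms(1) show False by (simp add: finite_image_iff)
qed

lemma UQ_group_ring_torsion:
  fixes g :: "'g::group_add"
  assumes "UQ_ring TYPE('g \<Rightarrow>\<^sub>0 'a::ring_1)"
  shows "\<exists>n>0. group_pow g n = 0"
proof (rule ccontr)
  assume "\<not> (\<exists>n>0. group_pow g n = 0)"
  then have inf: "group_pow g n \<noteq> 0" if "0 < n" for n using that by blast
  define s where "s = Poly_Mapping.single g (1::'a)"
  \<comment> \<open>The exponent 3 is odd, which makes the power sum a unit, and exceeds 1, which
    keeps \<open>g\<close> off the powers of \<open>t\<close>.\<close>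
  define t where "t = group_pow g 3"
  have "(\<Sum>i<3. s ^ i) \<in> ring_units"
    using UQ_ring_odd_power_sum_unit[OF assms single_1_unit, of 3] by (simp add: s_def)
  then obtain v where v: "(\<Sum>i<3. s ^ i) * v = 1" by (rule ring_unitsE)
  have "(1 - s ^ 3) * v = 1 - s"
    by (simp only: one_minus_mult_power_sum[symmetric] mult.assoc v mult_1_right)
  then have eq: "v - Poly_Mapping.single t 1 * v = 1 - s"
    by (simp add: left_diff_distrib s_def t_def single_power)
  \<comment> \<open>Along each orbit of translation by \<open>t\<close>, the coefficients of
    \<open>v\<close> can change only on arriving at \<open>0\<close> or \<open>g\<close>.\<close>
  have step: "Poly_Mapping.lookup v k - Poly_Mapping.lookup v (- t + k)
      = (1 when k = 0) - (1 when k = g)" for k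
    using arg_cong[OF eq, of "\<lambda>f. Poly_Mapping.lookup f k"]
    by (simp add: lookup_minus lookup_single_mult s_def lookup_one lookup_single when_def)
  have inj: "group_pow g m = group_pow g n \<longleftrightarrow> m = n" for m n
    using inj_group_pow[OF inf] by (auto dest: injD)
  have t: "group_pow t n = group_pow g (3 * n)" for n by (simp add: t_def group_pow_mult)
  have g: "g = group_pow g 1" by simp
  have "inj (group_pow t)" by (rule injI) (simp add: t inj)
  have "Poly_Mapping.lookup v (group_pow t n) = Poly_Mapping.lookup v 0" for n
  proof (induction n)
    case (Suc n)
    have "group_pow t (Suc n) \<noteq> 0" unfolding t by (rule inf) simp
    moreover have "group_pow t (Suc n) \<noteq> g"
    proof
      assume "group_pow t (Suc n) = g"
      then have "3 * Suc n = 1" by (subst (asm) g) (simp only: t inj)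
      then show False by simp
    qed
    ultimately show ?case using step[of "group_pow t (Suc n)"] Suc by (simp add: minus_add_cancel)
  qed simp
  from lookup_eq_0_if_const_on_inj[OF \<open>inj (group_pow t)\<close> this] have "Poly_Mapping.lookup v 0 = 0" .
  have neg: "- group_pow t n \<noteq> g" for n
  proof
    assume "- group_pow t n = g"
    then have "g + group_pow t n = 0" by (metis add.left_inverse minus_minus add.right_inverse)
    then have "group_pow g (Suc (3 * n)) = 0" by (simp add: t)
    with inf show False by blast
  qed
  \<comment> \<open>The negative side starts at \<open>- t\<close>, because the passage from
    \<open>- t\<close> to \<open>0\<close> is where the jump occurs.\<close>
  have "Poly_Mapping.lookup v (- group_pow t (Suc n)) = Poly_Mapping.lookup v (- t)" for n
  proof (induction n)
    case (Suc n)
    have "group_pow t (Suc n) \<noteq> 0" unfolding t by (rule inf) simp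
    then have "Poly_Mapping.lookup v (- group_pow t (Suc n))
        = Poly_Mapping.lookup v (- t + - group_pow t (Suc n))"
      using step[of "- group_pow t (Suc n)"] neg[of "Suc n"] by (simp del: group_pow_simps)
    also have "- t + - group_pow t (Suc n) = - group_pow t (Suc (Suc n))"
      using group_pow_simps(2)[of "- t" "Suc n"] by (simp only: group_pow_uminus)
    finally show ?case using Suc by simp
  qed simp
  moreover have "inj (\<lambda>n. - group_pow t (Suc n))"
    using \<open>inj (group_pow t)\<close> by (auto simp: inj_def simp del: group_pow_simps)
  ultimately have "Poly_Mapping.lookup v (- t) = 0" by (intro lookup_eq_0_if_const_on_inj)
  \<comment> \<open>As \<open>g\<close> is not \<open>0\<close>, the jump at \<open>0\<close> equals
    1, yet both coefficients vanish.\<close>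
  with step[of 0] \<open>Poly_Mapping.lookup v 0 = 0\<close> g inf[of 1] show False by auto
qed

section \<open>Orders are powers of 2\<close>

lemma UQ_group_ring_two_group:
  assumes "UQ_ring TYPE('g::group_add \<Rightarrow>\<^sub>0 'a::ring_1)"
  shows "two_group TYPE('g)"
  unfolding two_group_def
proof
  fix g :: 'g
  define n where "n = (LEAST n. 0 < n \<and> group_pow g n = 0)"
  have n: "0 < n \<and> group_pow g n = 0"
    unfolding n_def using UQ_group_ring_torsion[OF assms] by (rule LeastI_ex)
  have least: "n \<le> m" if "0 < m" "group_pow g m = 0" for m
    unfolding n_def using that by (intro Least_le) auto
  have "n \<noteq> 0" using n by simp
  moreover have "\<not> is_unit (2::nat)" by simp
  ultimately obtain m where "n = 2 ^ multiplicity 2 n * m" and "odd m"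
    by (rule multiplicity_decompose')
  then obtain k where nm: "n = 2 ^ k * m" by blast
  define h where "h = group_pow g (2 ^ k)"
  have "group_pow h m = 0" using n by (simp add: h_def nm group_pow_mult)
  then have "Poly_Mapping.single h (1::'a) ^ m = 1" by (simp add: single_power)
  \<comment> \<open>Comparing coefficients at \<open>h\<close> brings the equation back to the
    group: the left one is 1, which differs from 0, so \<open>h\<close> lies in the support of the
    identity.\<close>
  from UQ_ring_odd_torsion[OF assms this \<open>odd m\<close>]
  have "Poly_Mapping.lookup (Poly_Mapping.single h (1::'a)) h = Poly_Mapping.lookup 1 h" by simp
  then have "h = 0" by (simp add: lookup_one when_def split: if_splits)
  \<comment> \<open>Minimality of \<open>n = 2 ^ k * m\<close> now forces the odd factor
    \<open>m\<close> to be 1.\<close>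
  then have "n \<le> 2 ^ k" by (intro least) (simp_all add: h_def)
  with nm \<open>n \<noteq> 0\<close> have "n = 2 ^ k" by simp
  with n least show "\<exists>k. has_order g (2 ^ k)"
    unfolding has_order_def by (metis not_less)
qed

theorem theorem4p4:
  assumes "UQ_ring TYPE('g::group_add \<Rightarrow>\<^sub>0 'a::ring_1)"
  shows "UQ_ring TYPE('a) \<and> two_group TYPE('g)"
  using UQ_ring_coefficients[OF assms] UQ_group_ring_two_group[OF assms] by blast

end
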